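(* For all integers $p\ge1$, $q\ge0$, $n,m\ge0$ and all complex $z,w,\gamma$, $$H_{n+1,m}^{(p,q)}(z,w|\gamma)=z\,H_{n,m}^{(p,q)}(z,w|\gamma)+\gamma\,p!\,q!\binom{n}{p-1}\binom{m}{q}H_{n+1-p,m-q}^{(p,q)}(z,w|\gamma),$$ $$H_{n+1,m}^{(p,q)}(z,w|\gamma)=\left(z+p\gamma\,\partial_{z}^{p-1}\partial_{w}^{q}\right)H_{n,m}^{(p,q)}(z,w|\gamma).$$
   Context: For integers $p\ge 1$, $q,n,m\ge0$ and complex $z,w,\gamma$, $$H_{n,m}^{(p,q)}(z,w|\gamma)= n!\,m!\sum_{k=0}^{\lfloor n/p\rfloor\wedge\lfloor m/q\rfloor}\frac{\gamma^k}{k!}\frac{z^{n-pk}}{(n-pk)!}\frac{w^{m-qk}}{(m-qk)!},$$ where $a\wedge b=\min\{a,b\}$ and $\lfloor m/0\rfloor=+\infty$ by convention. Binomial coefficients $\binom{a}{b}$ vanish for $b>a\ge 0$, and a term whose binomial coefficients vanish (in particular when an index $n+1-p$ or $m-q$ is negative) is read as $0$. *)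

theory Defs
  imports "HOL-Analysis.Analysis"
begin

(* The upper summation limit follows the convention that m/0 is infinite, whereas
   m div 0 = 0 in HOL; hence the case distinction on q = 0.  (p is only ever positive.) *)
definition H_poly :: "nat \<Rightarrow> nat \<Rightarrow> nat \<Rightarrow> nat \<Rightarrow> complex \<Rightarrow> complex \<Rightarrow> complex \<Rightarrow> complex" where
  "H_poly p q n m \<gamma> z w =
     fact n * fact m *
     (\<Sum>k = 0..(if q = 0 then n div p else min (n div p) (m div q)).
        \<gamma> ^ k / fact k * (z ^ (n - p * k) / fact (n - p * k)) * (w ^ (m - q * k) / fact (m - q * k)))"

(* z and w are independent complex variables, so these are complex derivatives in one
   variable with the other held fixed. *)
definition partial_z :: "(complex \<Rightarrow> complex \<Rightarrow> complex) \<Rightarrow> complex \<Rightarrow> complex \<Rightarrow> complex" where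
  "partial_z f = (\<lambda>z w. deriv (\<lambda>\<zeta>. f \<zeta> w) z)"

definition partial_w :: "(complex \<Rightarrow> complex \<Rightarrow> complex) \<Rightarrow> complex \<Rightarrow> complex \<Rightarrow> complex" where
  "partial_w f = (\<lambda>z w. deriv (\<lambda>\<omega>. f z \<omega>) w)"

end

theory Submission
  imports Defs
begin

text \<open>Both right-hand sides come from the Appell structure of the divided powers
  \<open>z ^ i / fact i\<close>. Splitting \<open>n + 1 = (n + 1 - p k) + p k\<close> in the \<open>k\<close>-th term of
  \<open>H_poly p q (n + 1) m\<close>, the first part gives \<open>z * H_poly p q n m\<close>, while the factor \<open>k\<close> in the
  second cancels against \<open>1 / fact k\<close>, and shifting \<open>k\<close> by one gives the polynomial of index
  \<open>(n + 1 - p, m - q)\<close>. That polynomial is, up to a factor, the mixed derivative of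
  \<open>H_poly p q n m\<close>, because the partial derivatives lower the indices by one.\<close>

text \<open>Extending the divided power by zero beyond \<open>j = n\<close> removes truncated subtraction and makes
  the upper summation limit of \<open>H_poly\<close> immaterial.\<close>
definition divpow :: "complex \<Rightarrow> nat \<Rightarrow> nat \<Rightarrow> complex" where
  "divpow z n j = (if j \<le> n then z ^ (n - j) / fact (n - j) else 0)"

text \<open>Write \<open>n + 1 = (n + 1 - j) + j\<close>: the factor \<open>n + 1 - j\<close>
  cancels into the factorial and frees one power of \<open>z\<close>. The zero extension keeps this
  true for \<open>j > n\<close>, where only \<open>j = n + 1\<close> leaves nonzero terms.\<close>

lemma divpow_Suc:
  "of_nat (Suc n) * divpow z (Suc n) j = z * divpow z n j + of_nat j * divpow z (Suc n) j"
proof (cases "j \<le> n")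
  case True
  then obtain i where n: "n = j + i"
    by (auto simp: le_iff_add)
  have "divpow z (Suc n) j = z * z ^ i / (of_nat (Suc i) * fact i)"
    by (simp add: divpow_def n Suc_diff_le)
  moreover have "of_nat (Suc i) \<noteq> (0 :: complex)"
    by (rule of_nat_neq_0)
  ultimately have "of_nat (Suc i) * divpow z (Suc n) j = z * divpow z n j"
    by (simp add: divpow_def n del: of_nat_Suc)
  moreover have "of_nat (Suc n) = (of_nat (Suc i) + of_nat j :: complex)"
    by (simp add: n)
  ultimately show ?thesis
    by (simp only: distrib_right)
next
  case False
  then show ?thesis
    by (cases "j = Suc n") (auto simp: divpow_def)
qed

lemma divpow_add_right:
  "divpow z n (i + j) = (if i \<le> n then divpow z (n - i) j else 0)"
  by (auto simp: divpow_def)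

text \<open>The case \<open>n = 0\<close> stands apart because \<open>n - 1\<close> truncates to
  \<open>0\<close> and \<open>divpow z 0 0 = 1\<close>. For \<open>j = n > 0\<close> the zero
  extension already gives the derivative of a constant.\<close>

lemma has_field_derivative_divpow:
  "((\<lambda>z. divpow z n j) has_field_derivative (if n = 0 then 0 else divpow z (n - 1) j)) (at z)"
proof (cases "j < n")
  case True
  then obtain i where n: "n = Suc (j + i)"
    using less_iff_Suc_add by blast
  have "of_nat (Suc i) \<noteq> (0 :: complex)"
    by (rule of_nat_neq_0)
  then have "((\<lambda>z. z ^ Suc i / fact (Suc i)) has_field_derivative z ^ i / fact i) (at z)"
    by (auto intro!: derivative_eq_intros simp del: of_nat_Suc power_Suc)
  then show ?thesis
    by (simp add: divpow_def n Suc_diff_le)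
next
  case False
  then show ?thesis
    by (cases "j = n") (auto simp: divpow_def)
qed

text \<open>By \<open>p \<ge> 1\<close>, every \<open>k > n\<close> has \<open>p * k > n\<close> and
  contributes zero. The freedom in \<open>N\<close> lets sums for different indices share one
  range.\<close>

lemma H_poly_eq_sum_divpow:
  assumes "p \<ge> 1" "n \<le> N"
  shows "H_poly p q n m \<gamma> z w =
    fact n * fact m * (\<Sum>k\<le>N. \<gamma> ^ k / fact k * divpow z n (p * k) * divpow w m (q * k))"
proof -
  let ?B = "if q = 0 then n div p else min (n div p) (m div q)"
  \<comment> \<open>For \<open>q = 0\<close> the condition on \<open>m\<close> is void, in line with
    the infinite limit.\<close>
  have bound: "k \<le> ?B \<longleftrightarrow> p * k \<le> n \<and> q * k \<le> m" for k
    using assms(1) by (auto simp: less_eq_div_iff_mult_less_eq mult.commute)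
  have "?B \<le> N"
    using order_trans[OF div_le_dividend assms(2)] by (auto intro: min.coboundedI1)
  then have "(\<Sum>k\<le>N. \<gamma> ^ k / fact k * divpow z n (p * k) * divpow w m (q * k))
    = (\<Sum>k = 0..?B. \<gamma> ^ k / fact k * divpow z n (p * k) * divpow w m (q * k))"
    by (intro sum.mono_neutral_right) (use bound in \<open>auto simp: divpow_def simp del: if_split\<close>)
  also have "\<dots> = (\<Sum>k = 0..?B.
      \<gamma> ^ k / fact k * (z ^ (n - p * k) / fact (n - p * k)) * (w ^ (m - q * k) / fact (m - q * k)))"
    by (intro sum.cong refl) (metis atLeastAtMost_iff bound divpow_def)
  finally show ?thesis
    unfolding H_poly_def by simp
qed

text \<open>One step of the falling factorial \<open>n (n - 1) ... (n - j + 1)\<close>. Both sides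
  vanish once \<open>j \<ge> n\<close>, so truncation in \<open>n - j\<close> is harmless.\<close>

lemma fact_mult_binomial_Suc:
  "fact j * of_nat (n choose j) * of_nat (n - j)
    = (fact (Suc j) * of_nat (n choose Suc j) :: 'a :: {comm_semiring_1, semiring_char_0})"
proof -
  have "(n choose j) * (n - j) = Suc j * (n choose Suc j)"
    by (metis binomial_absorb_comp binomial_absorption mult.commute)
  then have "of_nat (n choose j) * of_nat (n - j)
      = (of_nat (Suc j) * of_nat (n choose Suc j) :: 'a)"
    by (metis of_nat_mult)
  then show ?thesis
    by (simp add: mult_ac del: of_nat_Suc)
qed

lemma fact_eq_binomial_mult:
  assumes "j \<le> n"
  shows "fact n = (fact j * of_nat (n choose j) * fact (n - j) :: 'a :: {comm_semiring_1, semiring_char_0})"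
proof -
  have "fact n = fact j * (n choose j) * fact (n - j)"
    using binomial_fact_lemma[OF assms] by (simp add: mult_ac)
  then show ?thesis
    by (metis of_nat_fact of_nat_mult)
qed

lemma H_poly_Suc:
  assumes "p \<ge> 1"
  shows "H_poly p q (Suc n) m \<gamma> z w = z * H_poly p q n m \<gamma> z w
    + \<gamma> * fact p * fact q * of_nat (n choose (p - 1)) * of_nat (m choose q)
      * H_poly p q (Suc n - p) (m - q) \<gamma> z w"
proof -
  define t where "t n m k = \<gamma> ^ k / fact k * divpow z n (p * k) * divpow w m (q * k)" for n m k
  have H: "H_poly p q n' m' \<gamma> z w = fact n' * fact m' * (\<Sum>k\<le>N. t n' m' k)" if "n' \<le> N" for n' m' N
    unfolding t_def by (rule H_poly_eq_sum_divpow[OF assms that])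
  have split: "of_nat (Suc n) * t (Suc n) m k = z * t n m k + of_nat p * (of_nat k * t (Suc n) m k)" for k
    using arg_cong[OF divpow_Suc[of n z "p * k"],
        of "\<lambda>x. \<gamma> ^ k / fact k * divpow w m (q * k) * x"]
    by (simp add: t_def algebra_simps add_divide_distrib)
  \<comment> \<open>As \<open>p * Suc k = p + p * k\<close>, and likewise for \<open>q\<close>, the
    offset moves into the indices, or the term is zero if an index would become negative.\<close>
  have shift: "of_nat (Suc k) * t (Suc n) m (Suc k)
      = (if p \<le> Suc n \<and> q \<le> m then \<gamma> * t (Suc n - p) (m - q) k else 0)" for k
  proof -
    have "of_nat (Suc k) \<noteq> (0 :: complex)"
      by (rule of_nat_neq_0)
    then have "of_nat (Suc k) * (\<gamma> ^ Suc k / fact (Suc k)) = \<gamma> * (\<gamma> ^ k / fact k)"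
      by (simp del: of_nat_Suc)
    then have "of_nat (Suc k) * t (Suc n) m (Suc k)
        = \<gamma> * (\<gamma> ^ k / fact k) * divpow z (Suc n) (p + p * k) * divpow w m (q + q * k)"
      by (simp only: t_def mult_Suc_right mult.assoc[symmetric])
    then show ?thesis
      by (simp add: divpow_add_right t_def)
  qed
  \<comment> \<open>The term \<open>k = 0\<close> drops out because of its factor
    \<open>k\<close>.\<close>
  have "(\<Sum>k\<le>Suc n. of_nat k * t (Suc n) m k)
      = (\<Sum>k\<le>n. of_nat (Suc k) * t (Suc n) m (Suc k))"
    by (simp add: sum.atMost_Suc_shift del: sum.atMost_Suc of_nat_Suc)
  also have "\<dots> = (if p \<le> Suc n \<and> q \<le> m then \<gamma> * (\<Sum>k\<le>n. t (Suc n - p) (m - q) k) else 0)"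
    by (simp only: shift) (auto simp: sum_distrib_left)
  finally have shifted: "(\<Sum>k\<le>Suc n. of_nat k * t (Suc n) m k) = \<dots>" .
  \<comment> \<open>With both new indices nonnegative, \<open>fact n\<close> and
    \<open>fact m\<close> factor through the binomials, and \<open>of_nat p\<close> completes
    \<open>fact (p - 1)\<close> to \<open>fact p\<close>. Otherwise \<open>p - 1 > n\<close> or
    \<open>q > m\<close>, and both sides vanish.\<close>
  have coeff: "\<gamma> * fact p * fact q * of_nat (n choose (p - 1)) * of_nat (m choose q)
      * H_poly p q (Suc n - p) (m - q) \<gamma> z w
    = fact n * fact m * (of_nat p * (\<Sum>k\<le>Suc n. of_nat k * t (Suc n) m k))"
  proof (cases "p \<le> Suc n \<and> q \<le> m")
    case True
    have "fact p = (of_nat p * fact (p - 1) :: complex)"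
      using assms by (simp add: fact_reduce)
    moreover have "fact n = (fact (p - 1) * of_nat (n choose (p - 1)) * fact (Suc n - p) :: complex)"
      using fact_eq_binomial_mult[of "p - 1" n, where 'a = complex] True assms
      by (simp add: le_diff_conv)
    moreover have "fact m = (fact q * of_nat (m choose q) * fact (m - q) :: complex)"
      using fact_eq_binomial_mult True by blast
    ultimately show ?thesis
      using True assms H[of "Suc n - p" n "m - q"] shifted by (simp add: mult_ac)
  next
    case False
    then have "(n choose (p - 1)) = 0 \<or> (m choose q) = 0"
      by auto
    then show ?thesis
      using False shifted by auto
  qed
  \<comment> \<open>The factor \<open>n + 1\<close> of \<open>fact (Suc n)\<close> goes inside the
    sum, where \<open>split\<close> acts on each term.\<close>
  have "H_poly p q (Suc n) m \<gamma> z w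
      = fact n * fact m * (\<Sum>k\<le>Suc n. of_nat (Suc n) * t (Suc n) m k)"
    using H[of "Suc n" "Suc n" m] by (simp add: sum_distrib_left mult_ac del: sum.atMost_Suc of_nat_Suc)
  also have "\<dots> = z * (fact n * fact m * (\<Sum>k\<le>Suc n. t n m k))
      + fact n * fact m * (of_nat p * (\<Sum>k\<le>Suc n. of_nat k * t (Suc n) m k))"
    by (simp only: split sum.distrib sum_distrib_left[symmetric]) (simp only: algebra_simps)
  finally show ?thesis
    using coeff H[of n "Suc n" m] by simp
qed

text \<open>The factor \<open>n\<close> is what \<open>fact n\<close> leaves over
  \<open>fact (n - 1)\<close>. It also gives the correct zero at \<open>n = 0\<close>, where
  \<open>n - 1\<close> truncates.\<close>

lemma has_field_derivative_H_poly_z: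
  assumes "p \<ge> 1"
  shows "((\<lambda>\<zeta>. H_poly p q n m \<gamma> \<zeta> w) has_field_derivative
    of_nat n * H_poly p q (n - 1) m \<gamma> z w) (at z)"
proof -
  have "((\<lambda>\<zeta>. H_poly p q n m \<gamma> \<zeta> w) has_field_derivative fact n * fact m *
      (\<Sum>k\<le>n. \<gamma> ^ k / fact k * (if n = 0 then 0 else divpow z (n - 1) (p * k)) * divpow w m (q * k))) (at z)"
    unfolding H_poly_eq_sum_divpow[OF assms order_refl]
    by (intro DERIV_cmult DERIV_sum DERIV_cmult_right has_field_derivative_divpow)
  then show ?thesis
    by (cases n) (simp_all add: H_poly_eq_sum_divpow[OF assms le_SucI[OF order_refl]] mult_ac)
qed

lemma has_field_derivative_H_poly_w:
  assumes "p \<ge> 1"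
  shows "((\<lambda>\<omega>. H_poly p q n m \<gamma> z \<omega>) has_field_derivative
    of_nat m * H_poly p q n (m - 1) \<gamma> z w) (at w)"
proof -
  have "((\<lambda>\<omega>. H_poly p q n m \<gamma> z \<omega>) has_field_derivative fact n * fact m *
      (\<Sum>k\<le>n. \<gamma> ^ k / fact k * divpow z n (p * k) * (if m = 0 then 0 else divpow w (m - 1) (q * k)))) (at w)"
    unfolding H_poly_eq_sum_divpow[OF assms order_refl]
    by (intro DERIV_cmult DERIV_sum has_field_derivative_divpow)
  then show ?thesis
    by (cases m) (simp_all add: H_poly_eq_sum_divpow[OF assms order_refl] mult_ac)
qed

text \<open>Each derivative contributes the next factor of a falling factorial. The constant
  \<open>c\<close> will absorb the factor left behind by the derivatives in
  \<open>w\<close>.\<close>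

lemma partial_z_funpow_H_poly:
  assumes "p \<ge> 1"
  shows "(partial_z ^^ j) (\<lambda>z w. c * H_poly p q n m \<gamma> z w)
    = (\<lambda>z w. c * (fact j * of_nat (n choose j)) * H_poly p q (n - j) m \<gamma> z w)"
proof (induction j)
  case (Suc j)
  have step: "partial_z (\<lambda>z w. c' * H_poly p q n' m \<gamma> z w)
      = (\<lambda>z w. c' * (of_nat n' * H_poly p q (n' - 1) m \<gamma> z w))" for c' n'
    unfolding partial_z_def
    by (intro ext DERIV_imp_deriv DERIV_cmult has_field_derivative_H_poly_z assms)
  show ?case
    unfolding funpow.simps o_apply Suc.IH step
    by (simp only: fact_mult_binomial_Suc[symmetric]
        mult.assoc diff_Suc_eq_diff_pred diff_commute[of n 1 j])
qed simp

lemma partial_w_funpow_H_poly: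
  assumes "p \<ge> 1"
  shows "(partial_w ^^ j) (\<lambda>z w. c * H_poly p q n m \<gamma> z w)
    = (\<lambda>z w. c * (fact j * of_nat (m choose j)) * H_poly p q n (m - j) \<gamma> z w)"
proof (induction j)
  case (Suc j)
  have step: "partial_w (\<lambda>z w. c' * H_poly p q n m' \<gamma> z w)
      = (\<lambda>z w. c' * (of_nat m' * H_poly p q n (m' - 1) \<gamma> z w))" for c' m'
    unfolding partial_w_def
    by (intro ext DERIV_imp_deriv DERIV_cmult has_field_derivative_H_poly_w assms)
  show ?case
    unfolding funpow.simps o_apply Suc.IH step
    by (simp only: fact_mult_binomial_Suc[symmetric]
        mult.assoc diff_Suc_eq_diff_pred diff_commute[of m 1 j])
qed simp

theorem proposition6p4:
  fixes p q n m :: nat and z w \<gamma> :: complex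
  assumes "p \<ge> 1"
  shows "H_poly p q (n + 1) m \<gamma> z w =
           z * H_poly p q n m \<gamma> z w
           + \<gamma> * fact p * fact q * of_nat (n choose (p - 1)) * of_nat (m choose q)
             * H_poly p q (n + 1 - p) (m - q) \<gamma> z w
       \<and> H_poly p q (n + 1) m \<gamma> z w =
           z * H_poly p q n m \<gamma> z w
           + of_nat p * \<gamma> * ((partial_z ^^ (p - 1)) ((partial_w ^^ q) (H_poly p q n m \<gamma>))) z w"
proof -
  \<comment> \<open>The inner derivatives start from \<open>c = 1\<close>; their output is again a
    constant multiple of some \<open>H_poly\<close>, as the derivatives in \<open>z\<close>
    require.\<close>
  have "((partial_z ^^ (p - 1)) ((partial_w ^^ q) (H_poly p q n m \<gamma>))) z w
      = fact q * of_nat (m choose q) * (fact (p - 1) * of_nat (n choose (p - 1)))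
        * H_poly p q (n - (p - 1)) (m - q) \<gamma> z w"
    using partial_w_funpow_H_poly[OF assms, of q 1 q n m \<gamma>]
    by (simp add: partial_z_funpow_H_poly[OF assms])
  moreover have "n - (p - 1) = Suc n - p"
    using assms by simp
  moreover have "fact p = (of_nat p * fact (p - 1) :: complex)"
    using assms by (simp add: fact_reduce)
  ultimately show ?thesis
    using H_poly_Suc[OF assms, of q n m \<gamma> z w] by (simp add: mult_ac)
qed

end
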